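(* Consider the infinite overparameterization limit $\phi/\psi\to\infty$ of random feature regression, and let $\mu$ be an LJSD with equal training and test scales, $\mathbb{E}_\mu[\lambda]=\mathbb{E}_\mu[r]$. Viewing the limiting test error as a function $E_\mu(\gamma)$ of the ridge constant $\gamma\ge-\rho\omega$, the optimal regularization $\gamma^{\text{opt}}_\mu$ is independent of $\mu$ and satisfies $$\gamma^{\text{opt}}_\mu:=\arg\min_{\gamma\ge-\rho\omega}E_\mu(\gamma)=\rho(\sigma_\varepsilon^2-\omega)\qquad\text{and}\qquad E^{\text{opt}}_\mu:=E_\mu(\gamma^{\text{opt}}_\mu)=\mathcal{I}^*_{1,1}$$ (with $\mathcal{I}^*_{1,1}$ evaluated at the value of $x$ corresponding to $\gamma=\gamma_\mu^{\text{opt}}$). Moreover, the optimal error is ordered with respect to shift strength: for two such LJSDs $\mu_1\le\mu_2$, $E^{\text{opt}}_{\mu_1}\le E^{\text{opt}}_{\mu_2}$.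
   Context: Parameters: $\phi>0$, label noise $\sigma_\varepsilon^2\ge0$. Activation $\sigma:\mathbb{R}\to\mathbb{R}$, differentiable almost everywhere with $|\sigma(u)|,|\sigma'(u)|\le c_0e^{c_1|u|}$. LJSD: a limiting joint spectral distribution is a probability measure $\mu$ on $\mathbb{R}_+^2$, the law of a pair $(\lambda,r)$ (training eigenvalue, overlap coefficient of the test covariance), supported in $[0,C]^2$ for some $C$, either absolutely continuous or a finite sum of delta masses; $\mathbb{E}_\mu[\lambda],\mathbb{E}_\mu[r]$ are finite and positive. The marginal of $\lambda$ is $\mu_{\text{train}}$. Order: for LJSDs $\mu_1,\mu_2$ with the same marginal of $\lambda$, $\mu_1\le\mu_2$ means that $\mathbb{E}_{\mu_1}[r|\lambda]/\mathbb{E}_{\mu_2}[r|\lambda]$ is nondecreasing in $\lambda$ on the support of $\mu_{\text{train}}$ and $\mathbb{E}_{\mu_1}[r]\le\mathbb{E}_{\mu_2}[r]$. Constants: with $s=\mathbb{E}_\mu[\lambda]$ and $z\sim\mathcal N(0,s)$: $\eta=\mathbb{V}[\sigma(z)]$, $\rho=(\frac1s\mathbb{E}[z\sigma(z)])^2$, $\zeta=s\rho$, $\omega=s(\eta/\zeta-1)$ (assumed well defined). Functionals: $\mathcal{I}_{a,b}(x)=\phi\,\mathbb{E}_\mu[\lambda^a(\phi+x\lambda)^{-b}]$, $\mathcal{I}^*_{a,b}(x)=\phi\,\mathbb{E}_\mu[r\lambda^{a-1}(\phi+x\lambda)^{-b}]$. Limiting test error as $\phi/\psi\to\infty$ ($\phi$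 fixed) under equal scales (so that the scale ratio $\xi$ equals $1$): with $\gamma_{\text{eff}}=\gamma/\rho+\omega$ and $x$ the unique positive real root of $x=1/(\gamma_{\text{eff}}+\mathcal{I}_{1,1}(x))$, functionals evaluated at $x$, $$E_\mu(\gamma)=B_\mu+V_\mu,\qquad B_\mu=\phi\,\mathcal{I}^*_{1,2},\qquad V_\mu=\frac{\sigma_\varepsilon^2+\phi\mathcal{I}_{1,2}}{\gamma_{\text{eff}}+\phi\mathcal{I}_{1,2}}\,x\,\mathcal{I}^*_{2,2}.$$
   Formalization: That the minimizer is unique is claimed only if E[λr]>0 (otherwise the error is constant in γ); at γ=−ρω, when no positive root x exists, the error and I*_{1,1} are read as limits from the right, possibly infinite. *)

theory Defs
  imports "HOL-Probability.Probability"
begin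

section \<open>Limiting joint spectral distributions\<close>

text \<open>A measure \<open>\<mu>\<close> on pairs \<open>(l, r)\<close>: training eigenvalue and overlap coefficient.\<close>

definition train_scale :: "(real \<times> real) measure \<Rightarrow> real" where
  "train_scale \<mu> = (\<integral>p. fst p \<partial>\<mu>)"

definition test_scale :: "(real \<times> real) measure \<Rightarrow> real" where
  "test_scale \<mu> = (\<integral>p. snd p \<partial>\<mu>)"

definition finite_sum_of_deltas :: "(real \<times> real) measure \<Rightarrow> bool" where
  "finite_sum_of_deltas \<mu> \<longleftrightarrow>
     (\<exists>S (w :: real \<times> real \<Rightarrow> ennreal). finite S \<and>
        (\<forall>A \<in> sets borel. emeasure \<mu> A = (\<Sum>p\<in>S. w p * emeasure (return borel p) A)))"

definition LJSD :: "(real \<times> real) measure \<Rightarrow> bool" where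
  "LJSD \<mu> \<longleftrightarrow>
     prob_space \<mu> \<and> sets \<mu> = sets borel \<and>
     (\<exists>C. AE p in \<mu>. p \<in> {0..C} \<times> {0..C}) \<and>
     (absolutely_continuous lborel \<mu> \<or> finite_sum_of_deltas \<mu>) \<and>
     integrable \<mu> fst \<and> integrable \<mu> snd \<and>
     0 < train_scale \<mu> \<and> 0 < test_scale \<mu>"

definition mu_train :: "(real \<times> real) measure \<Rightarrow> real measure" where
  "mu_train \<mu> = distr \<mu> borel fst"

definition msupport :: "real measure \<Rightarrow> real set" where
  "msupport M = {x. \<forall>e>0. 0 < emeasure M (ball x e)}"

section \<open>The order by shift strength\<close>

text \<open>\<open>f\<close> is a version of the function \<open>l \<mapsto> E[r | \<lambda> = l]\<close>. It is determined only almost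
  everywhere with respect to the marginal, and can be taken nonnegative because \<open>r \<ge> 0\<close>.\<close>

definition cond_mean_version :: "(real \<times> real) measure \<Rightarrow> (real \<Rightarrow> real) \<Rightarrow> bool" where
  "cond_mean_version \<mu> f \<longleftrightarrow>
     f \<in> borel_measurable borel \<and> (\<forall>l. 0 \<le> f l) \<and>
     (AE p in \<mu>. real_cond_exp \<mu> (vimage_algebra (space \<mu>) fst borel) snd p = f (fst p))"

text \<open>Since conditional expectations are determined only almost everywhere, the monotonicity of
  the ratio is required of some pair of versions. The quotient is taken in \<open>ennreal\<close>: there a
  positive number divided by \<open>0\<close> is \<open>\<infinity>\<close>, whereas the real quotient would be \<open>0\<close>. Points where
  the ratio has the indeterminate form \<open>0 / 0\<close> are left unconstrained.\<close>

definition shift_le :: "(real \<times> real) measure \<Rightarrow> (real \<times> real) measure \<Rightarrow> bool" where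
  "shift_le \<mu>1 \<mu>2 \<longleftrightarrow>
     mu_train \<mu>1 = mu_train \<mu>2 \<and>
     (\<exists>f1 f2. cond_mean_version \<mu>1 f1 \<and> cond_mean_version \<mu>2 f2 \<and>
        mono_on {l \<in> msupport (mu_train \<mu>1). \<not> (f1 l = 0 \<and> f2 l = 0)}
          (\<lambda>l. ennreal (f1 l) / ennreal (f2 l))) \<and>
     test_scale \<mu>1 \<le> test_scale \<mu>2"

section \<open>Activation function and its Gaussian constants\<close>

definition activation :: "(real \<Rightarrow> real) \<Rightarrow> bool" where
  "activation \<sigma> \<longleftrightarrow>
     (AE u in lborel. \<sigma> differentiable (at u)) \<and>
     (\<exists>c0 c1. (\<forall>u. \<bar>\<sigma> u\<bar> \<le> c0 * exp (c1 * \<bar>u\<bar>)) \<and>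
              (\<forall>u. \<sigma> differentiable (at u) \<longrightarrow> \<bar>deriv \<sigma> u\<bar> \<le> c0 * exp (c1 * \<bar>u\<bar>)))"

text \<open>The law \<open>N(0, s)\<close>, with variance \<open>s\<close>. The reference measure is \<open>lebesgue\<close> and not \<open>lborel\<close>
  because an almost everywhere differentiable function is Lebesgue but in general not Borel
  measurable.\<close>

definition gaussian :: "real \<Rightarrow> real measure" where
  "gaussian s = density lebesgue (\<lambda>z. ennreal (normal_density 0 (sqrt s) z))"

definition act_eta :: "(real \<Rightarrow> real) \<Rightarrow> real \<Rightarrow> real" where
  "act_eta \<sigma> s = (\<integral>z. (\<sigma> z - (\<integral>y. \<sigma> y \<partial>gaussian s))\<^sup>2 \<partial>gaussian s)"

definition act_rho :: "(real \<Rightarrow> real) \<Rightarrow> real \<Rightarrow> real" where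
  "act_rho \<sigma> s = (1 / s * (\<integral>z. z * \<sigma> z \<partial>gaussian s))\<^sup>2"

definition act_zeta :: "(real \<Rightarrow> real) \<Rightarrow> real \<Rightarrow> real" where
  "act_zeta \<sigma> s = s * act_rho \<sigma> s"

definition act_omega :: "(real \<Rightarrow> real) \<Rightarrow> real \<Rightarrow> real" where
  "act_omega \<sigma> s = s * (act_eta \<sigma> s / act_zeta \<sigma> s - 1)"

section \<open>Limiting test error\<close>

definition Ifun :: "real \<Rightarrow> (real \<times> real) measure \<Rightarrow> nat \<Rightarrow> nat \<Rightarrow> real \<Rightarrow> real" where
  "Ifun \<phi> \<mu> a b x = \<phi> * (\<integral>p. fst p ^ a / (\<phi> + x * fst p) ^ b \<partial>\<mu>)"

text \<open>Only meant for \<open>a \<ge> 1\<close>; for \<open>a = 1\<close> the factor \<open>\<lambda>\<^sup>0\<close> is \<open>1\<close>, also at \<open>\<lambda> = 0\<close>.\<close>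

definition Istar :: "real \<Rightarrow> (real \<times> real) measure \<Rightarrow> nat \<Rightarrow> nat \<Rightarrow> real \<Rightarrow> real" where
  "Istar \<phi> \<mu> a b x = \<phi> * (\<integral>p. snd p * fst p ^ (a - 1) / (\<phi> + x * fst p) ^ b \<partial>\<mu>)"

definition is_root :: "real \<Rightarrow> (real \<times> real) measure \<Rightarrow> real \<Rightarrow> real \<Rightarrow> bool" where
  "is_root \<phi> \<mu> g x \<longleftrightarrow> 0 < x \<and> x = 1 / (g + Ifun \<phi> \<mu> 1 1 x)"

definition root_x :: "real \<Rightarrow> (real \<times> real) measure \<Rightarrow> real \<Rightarrow> real" where
  "root_x \<phi> \<mu> g = (THE x. is_root \<phi> \<mu> g x)"

text \<open>The value of a quantity \<open>Q g x\<close> at effective ridge constant \<open>g \<ge> 0\<close> and at the root \<open>x\<close>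
  belonging to \<open>g\<close>. For \<open>g > 0\<close> there is exactly one root. At the end point \<open>g = 0\<close> (the
  ridgeless case) there is none if \<open>\<phi> * \<mu>{\<lambda> > 0} \<le> 1\<close>, as \<open>x\<close> tends to infinity when \<open>g\<close>
  decreases to \<open>0\<close>; the value is then the limit from the right. The limit is taken in \<open>ereal\<close>
  because the test error can diverge there.\<close>

definition at_root ::
  "real \<Rightarrow> (real \<times> real) measure \<Rightarrow> (real \<Rightarrow> real \<Rightarrow> real) \<Rightarrow> real \<Rightarrow> ereal" where
  "at_root \<phi> \<mu> Q g =
     (if \<exists>!x. is_root \<phi> \<mu> g x then ereal (Q g (root_x \<phi> \<mu> g))
      else Lim (at_right g) (\<lambda>g'. ereal (Q g' (root_x \<phi> \<mu> g'))))"

definition bias :: "real \<Rightarrow> (real \<times> real) measure \<Rightarrow> real \<Rightarrow> real" where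
  "bias \<phi> \<mu> x = \<phi> * Istar \<phi> \<mu> 1 2 x"

text \<open>\<open>v\<close> is the variance of the label noise.\<close>

definition variance_term ::
  "real \<Rightarrow> real \<Rightarrow> (real \<times> real) measure \<Rightarrow> real \<Rightarrow> real \<Rightarrow> real" where
  "variance_term \<phi> v \<mu> g x =
     (v + \<phi> * Ifun \<phi> \<mu> 1 2 x) / (g + \<phi> * Ifun \<phi> \<mu> 1 2 x) * x * Istar \<phi> \<mu> 2 2 x"

definition gamma_eff :: "(real \<Rightarrow> real) \<Rightarrow> real \<Rightarrow> real \<Rightarrow> real" where
  "gamma_eff \<sigma> s \<gamma> = \<gamma> / act_rho \<sigma> s + act_omega \<sigma> s"

definition test_error ::
  "real \<Rightarrow> real \<Rightarrow> (real \<Rightarrow> real) \<Rightarrow> (real \<times> real) measure \<Rightarrow> real \<Rightarrow> ereal" where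
  "test_error \<phi> v \<sigma> \<mu> \<gamma> =
     at_root \<phi> \<mu> (\<lambda>g x. bias \<phi> \<mu> x + variance_term \<phi> v \<mu> g x)
       (gamma_eff \<sigma> (train_scale \<mu>) \<gamma>)"

end

theory Submission
  imports Defs
begin

text \<open>Write \<open>g\<close> for the effective ridge constant and \<open>h g\<close> for \<open>I\<^sup>*\<^sub>1\<^sub>,\<^sub>1\<close> at the root belonging to \<open>g\<close>.
  The test error equals \<open>h g + h' g * (v - g)\<close>, the value at \<open>v\<close> of the tangent line of \<open>h\<close> at \<open>g\<close>.
  In the variable \<open>t = 1 / x\<close> the defining equation gives \<open>g\<close> as a convex function of \<open>t\<close>, increasing
  where \<open>g \<ge> 0\<close>, and \<open>I\<^sup>*\<^sub>1\<^sub>,\<^sub>1\<close> is increasing and concave in \<open>t\<close>. Hence \<open>h\<close> is concave, lies below its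
  tangents, and the error is at least \<open>h v\<close>, its value for \<open>g = v\<close>. In the ridgeless case the error
  is monotone in \<open>g\<close> near \<open>0\<close>, so that the limit exists. For the order, two measures with the same
  marginal have the same roots, and the difference of the conditional means changes sign at most
  once while \<open>1 / (\<phi> + x * l)\<close> decreases in \<open>l\<close>.\<close>

section \<open>Limits from the right\<close>

text \<open>Monotone convergence from the right. Monotonicity is asked only up to \<open>e\<close>,
  since the error is known to decrease only left of the noise level; \<open>ereal\<close> provides
  the supremum even if the error diverges.\<close>

lemma antimono_tendsto_at_right:
  fixes f :: "real \<Rightarrow> ereal"
  assumes e: "a < e" and f: "\<And>x y. a < x \<Longrightarrow> x \<le> y \<Longrightarrow> y < e \<Longrightarrow> f y \<le> f x"
  shows "(f \<longlongrightarrow> (SUP x\<in>{a<..<e}. f x)) (at_right a)"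
proof (rule order_tendstoI)
  fix l assume "l < (SUP x\<in>{a<..<e}. f x)"
  then obtain y where y: "a < y" "y < e" "l < f y" by (auto simp: less_SUP_iff)
  have "l < f x" if "a < x" "x < y" for x
    using f[of x y] that y by (meson less_imp_le less_le_trans)
  then show "eventually (\<lambda>x. l < f x) (at_right a)"
    using y(1) unfolding eventually_at_right_field by blast
next
  fix u assume u: "(SUP x\<in>{a<..<e}. f x) < u"
  have "f x < u" if "a < x" "x < e" for x
    using SUP_upper[of x "{a<..<e}" f] that u by (auto intro: le_less_trans)
  then show "eventually (\<lambda>x. f x < u) (at_right a)"
    using e unfolding eventually_at_right_field by blast
qed

text \<open>Follows from the antitone case by negation. The limit is written as \<open>Lim\<close>
  because \<open>at_root\<close> is defined that way.\<close>

lemma mono_tendsto_at_right: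
  fixes f :: "real \<Rightarrow> ereal"
  assumes f: "\<And>x y. a < x \<Longrightarrow> x \<le> y \<Longrightarrow> f x \<le> f y"
  shows "(f \<longlongrightarrow> Lim (at_right a) f) (at_right a)"
proof -
  have "((\<lambda>x. - f x) \<longlongrightarrow> (SUP x\<in>{a<..<a+1}. - f x)) (at_right a)"
    by (rule antimono_tendsto_at_right) (auto intro: f)
  then have "((\<lambda>x. - (- f x)) \<longlongrightarrow> - (SUP x\<in>{a<..<a+1}. - f x)) (at_right a)"
    by (rule tendsto_uminus_ereal)
  then have l: "(f \<longlongrightarrow> - (SUP x\<in>{a<..<a+1}. - f x)) (at_right a)" by simp
  show ?thesis using l tendsto_Lim[OF _ l] by simp
qed

section \<open>Moments of a joint spectral distribution\<close>

locale joint_spectrum = prob_space \<mu> for \<mu> :: "(real \<times> real) measure" +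
  fixes \<phi> :: real
  assumes phi_pos: "0 < \<phi>"
    and nonneg: "AE p in \<mu>. 0 \<le> fst p \<and> 0 \<le> snd p"
    and integrable_fst: "integrable \<mu> fst"
    and integrable_snd: "integrable \<mu> snd"
    and train_pos: "0 < train_scale \<mu>"
begin

lemma measurable_fst_mu [measurable]: "fst \<in> borel_measurable \<mu>"
  using integrable_fst by simp

lemma measurable_snd_mu [measurable]: "snd \<in> borel_measurable \<mu>"
  using integrable_snd by simp

text \<open>The free weight \<open>q\<close> lets one concavity argument serve both families of
  functionals: \<open>q = fst\<close> for \<open>Ifun\<close> and \<open>q = snd\<close> for
  \<open>Istar\<close>, with the index \<open>a\<close> shifted by one.\<close>

definition moment :: "(real \<times> real \<Rightarrow> real) \<Rightarrow> nat \<Rightarrow> nat \<Rightarrow> real \<Rightarrow> real" where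
  "moment q a b x = (\<integral>p. q p * fst p ^ a / (\<phi> + x * fst p) ^ b \<partial>\<mu>)"

lemma Istar_moment: "Istar \<phi> \<mu> (Suc a) b x = \<phi> * moment snd a b x"
  by (simp add: Istar_def moment_def)

lemma Ifun_moment: "Ifun \<phi> \<mu> (Suc a) b x = \<phi> * moment fst a b x"
  by (simp add: Ifun_def moment_def)

lemma denominator_pos:
  assumes "0 < x" "0 \<le> l" shows "0 < \<phi> + x * l"
  using assms phi_pos by (simp add: add_pos_nonneg)

text \<open>For \<open>a \<le> b\<close> the factor multiplying \<open>q\<close> is bounded, because
  \<open>l / (\<phi> + x * l) \<le> 1 / x\<close> and
  \<open>1 / (\<phi> + x * l) \<le> 1 / \<phi>\<close>.\<close>

lemma integrable_moment:
  assumes q: "integrable \<mu> q" and x: "0 < x" and ab: "a \<le> b"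
  shows "integrable \<mu> (\<lambda>p. q p * fst p ^ a / (\<phi> + x * fst p) ^ b)"
proof (rule Bochner_Integration.integrable_bound)
  let ?B = "(1 / x) ^ a * (1 / \<phi>) ^ (b - a)"
  show "integrable \<mu> (\<lambda>p. ?B * q p)" using q by simp
  have [measurable]: "q \<in> borel_measurable \<mu>" using q by simp
  show "(\<lambda>p. q p * fst p ^ a / (\<phi> + x * fst p) ^ b) \<in> borel_measurable \<mu>" by measurable
  show "AE p in \<mu>. norm (q p * fst p ^ a / (\<phi> + x * fst p) ^ b) \<le> norm (?B * q p)"
    using nonneg
  proof eventually_elim
    case (elim p)
    let ?d = "\<phi> + x * fst p"
    have d: "0 < ?d" using denominator_pos[OF x] elim by simp
    have "fst p ^ a / ?d ^ b = (fst p / ?d) ^ a * (1 / ?d) ^ (b - a)"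
      using ab d by (simp add: power_divide flip: power_add)
    also have "\<dots> \<le> ?B"
      using d elim x phi_pos
      by (intro mult_mono power_mono) (auto simp: field_simps)
    finally have "\<bar>q p\<bar> * (fst p ^ a / ?d ^ b) \<le> \<bar>q p\<bar> * ?B"
      by (rule mult_left_mono) simp
    then show ?case
      using d elim x phi_pos by (simp add: abs_mult mult.commute)
  qed
qed

lemma moment_nonneg:
  assumes "AE p in \<mu>. 0 \<le> q p" and "0 < x"
  shows "0 \<le> moment q a b x"
  unfolding moment_def
proof (rule integral_nonneg_AE)
  show "AE p in \<mu>. 0 \<le> q p * fst p ^ a / (\<phi> + x * fst p) ^ b"
    using assms(1) nonneg
    by eventually_elim (use denominator_pos[OF assms(2)] in \<open>auto simp: less_imp_le\<close>)
qed

text \<open>A vanishing integral would force \<open>fst p = 0\<close> almost everywhere, against the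
  positive training scale.\<close>

lemma moment_fst_pos:
  assumes x: "0 < x"
  shows "0 < moment fst 0 b x"
proof (rule ccontr)
  assume "\<not> 0 < moment fst 0 b x"
  moreover have n: "AE p in \<mu>. 0 \<le> fst p" using nonneg by auto
  ultimately have "moment fst 0 b x = 0" using moment_nonneg[OF n x, of 0 b] by simp
  then have "(\<integral>p. fst p / (\<phi> + x * fst p) ^ b \<partial>\<mu>) = 0" by (simp add: moment_def)
  moreover have "AE p in \<mu>. 0 \<le> fst p / (\<phi> + x * fst p) ^ b"
    using n by eventually_elim (use denominator_pos[OF x] in \<open>auto simp: less_imp_le\<close>)
  ultimately have "AE p in \<mu>. fst p / (\<phi> + x * fst p) ^ b = 0"
    using integral_nonneg_eq_0_iff_AE[of \<mu> "\<lambda>p. fst p / (\<phi> + x * fst p) ^ b"]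
      integrable_moment[OF integrable_fst x, of 0 b] by simp
  then have "AE p in \<mu>. fst p = 0"
    using n by eventually_elim (use denominator_pos[OF x] in fastforce)
  then have "train_scale \<mu> = 0"
    unfolding train_scale_def by (simp cong: integral_cong_AE add: integral_eq_zero_AE)
  then show False using train_pos by simp
qed

text \<open>With \<open>d = \<phi> + x * fst p\<close>, this integrates the identity
  \<open>1 / d = d / d ^ 2\<close>.\<close>

lemma moment_split:
  assumes q: "integrable \<mu> q" and x: "0 < x"
  shows "moment q 0 1 x = \<phi> * moment q 0 2 x + x * moment q 1 2 x"
proof -
  have "moment q 0 1 x =
      (\<integral>p. \<phi> * (q p * fst p ^ 0 / (\<phi> + x * fst p) ^ 2)
         + x * (q p * fst p ^ 1 / (\<phi> + x * fst p) ^ 2) \<partial>\<mu>)"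
    unfolding moment_def
  proof (rule integral_cong_AE)
    have [measurable]: "q \<in> borel_measurable \<mu>" using q by simp
    show "(\<lambda>p. q p * fst p ^ 0 / (\<phi> + x * fst p) ^ 1) \<in> borel_measurable \<mu>"
      "(\<lambda>p. \<phi> * (q p * fst p ^ 0 / (\<phi> + x * fst p) ^ 2)
         + x * (q p * fst p ^ 1 / (\<phi> + x * fst p) ^ 2)) \<in> borel_measurable \<mu>"
      by measurable
    show "AE p in \<mu>. q p * fst p ^ 0 / (\<phi> + x * fst p) ^ 1 =
      \<phi> * (q p * fst p ^ 0 / (\<phi> + x * fst p) ^ 2)
         + x * (q p * fst p ^ 1 / (\<phi> + x * fst p) ^ 2)"
      using nonneg
    proof eventually_elim
      case (elim p)
      let ?d = "\<phi> + x * fst p"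
      have "?d \<noteq> 0" using denominator_pos[OF x, of "fst p"] elim by simp
      then have "q p / ?d = q p * ?d / ?d\<^sup>2" by (simp add: power2_eq_square)
      then show ?case by (simp add: add_divide_distrib algebra_simps)
    qed
  qed
  also have "\<dots> = \<phi> * moment q 0 2 x + x * moment q 1 2 x"
    unfolding moment_def
    using integrable_moment[OF q x, of 0 2] integrable_moment[OF q x, of 1 2]
    by (simp del: times_divide_eq_right)
  finally show ?thesis .
qed

text \<open>In the variable \<open>t = 1 / x\<close> the integrand \<open>1 / (\<phi> + x * l)\<close> is \<open>t / (\<phi> * t + l)\<close>, which is
  concave in \<open>t\<close>; this is the gap between the tangent line at \<open>1 / x\<close> and the function at
  \<open>1 / y\<close>.\<close>

lemma tangent_gap:
  fixes l x y :: real
  assumes "0 < x" "0 < y" "0 \<le> l"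
  shows "1 / (\<phi> + x * l) + (x / y - 1) * x * (l / (\<phi> + x * l)\<^sup>2) - 1 / (\<phi> + y * l) =
    \<phi> * l * (x - y)\<^sup>2 / (y * (\<phi> + y * l) * (\<phi> + x * l)\<^sup>2)"
proof -
  define a where "a = \<phi> + x * l"
  define b where "b = \<phi> + y * l"
  have ab: "a \<noteq> 0" "b \<noteq> 0" "y \<noteq> 0"
    using assms denominator_pos[of x l] denominator_pos[of y l] by (auto simp: a_def b_def)
  have "1 / a + (x / y - 1) * x * (l / a\<^sup>2) - 1 / b =
    (a * b * y + (x - y) * x * l * b - a\<^sup>2 * y) / (y * b * a\<^sup>2)"
    using ab by (simp add: field_simps power2_eq_square)
  also have "a * b * y + (x - y) * x * l * b - a\<^sup>2 * y = \<phi> * l * (x - y)\<^sup>2"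
    unfolding a_def b_def by (simp add: algebra_simps power2_eq_square)
  finally show ?thesis by (simp add: a_def b_def)
qed

text \<open>Integrates \<open>tangent_gap\<close> against \<open>q\<close>. Keeping the gap as the
  integral of a nonnegative function serves both the weak and the strict inequality below.\<close>

lemma moment_tangent_gap:
  assumes q: "integrable \<mu> q" and q0: "AE p in \<mu>. 0 \<le> q p" and x: "0 < x" and y: "0 < y"
  defines "G \<equiv> \<lambda>p. q p * (\<phi> * fst p * (x - y)\<^sup>2 /
    (y * (\<phi> + y * fst p) * (\<phi> + x * fst p)\<^sup>2))"
  shows "integrable \<mu> G" and "AE p in \<mu>. 0 \<le> G p"
    and "moment q 0 1 x + (x / y - 1) * x * moment q 1 2 x - moment q 0 1 y = (\<integral>p. G p \<partial>\<mu>)"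
proof -
  have [measurable]: "q \<in> borel_measurable \<mu>" using q by simp
  let ?F = "\<lambda>p. q p * fst p ^ 0 / (\<phi> + x * fst p) ^ 1
    + (x / y - 1) * x * (q p * fst p ^ 1 / (\<phi> + x * fst p) ^ 2)
    - q p * fst p ^ 0 / (\<phi> + y * fst p) ^ 1"
  have eq: "AE p in \<mu>. ?F p = G p"
    using nonneg
  proof eventually_elim
    case (elim p)
    have "?F p = q p * (1 / (\<phi> + x * fst p)
        + (x / y - 1) * x * (fst p / (\<phi> + x * fst p)\<^sup>2) - 1 / (\<phi> + y * fst p))"
      by (simp add: algebra_simps)
    also have "\<dots> = G p" unfolding G_def using tangent_gap[OF x y] elim by simp
    finally show ?case .
  qed
  have iF: "integrable \<mu> ?F"
    using integrable_moment[OF q x, of 0 1] integrable_moment[OF q x, of 1 2]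
      integrable_moment[OF q y, of 0 1]
    by (intro Bochner_Integration.integrable_add Bochner_Integration.integrable_diff
        integrable_mult_right) auto
  have [measurable]: "G \<in> borel_measurable \<mu>" unfolding G_def by measurable
  show "integrable \<mu> G"
    by (rule integrable_cong_AE_imp[OF iF]) (use eq in auto)
  show "AE p in \<mu>. 0 \<le> G p"
    using q0 nonneg
    by eventually_elim
      (use denominator_pos[OF x] denominator_pos[OF y] y phi_pos in
        \<open>auto simp: G_def less_imp_le intro!: mult_nonneg_nonneg divide_nonneg_nonneg\<close>)
  have "(\<integral>p. ?F p \<partial>\<mu>) = (\<integral>p. G p \<partial>\<mu>)"
    by (rule integral_cong_AE) (use eq iF in auto)
  then show "moment q 0 1 x + (x / y - 1) * x * moment q 1 2 x - moment q 0 1 y = (\<integral>p. G p \<partial>\<mu>)"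
    unfolding moment_def
    using integrable_moment[OF q x, of 0 1] integrable_moment[OF q x, of 1 2]
      integrable_moment[OF q y, of 0 1] by (simp del: times_divide_eq_right)
qed

text \<open>Concavity in \<open>t = 1 / x\<close>: the derivative in \<open>t\<close> is
  \<open>x ^ 2 * moment q 1 2 x\<close>, and \<open>(x / y - 1) * x\<close> equals
  \<open>(1 / y - 1 / x) * x ^ 2\<close>.\<close>

lemma moment_tangent:
  assumes "integrable \<mu> q" and "AE p in \<mu>. 0 \<le> q p" and "0 < x" and "0 < y"
  shows "moment q 0 1 y \<le> moment q 0 1 x + (x / y - 1) * x * moment q 1 2 x"
  using moment_tangent_gap(3)[OF assms] integral_nonneg_AE[OF moment_tangent_gap(2)[OF assms]]
  by simp

text \<open>If the gap integral vanishes, so does its integrand almost everywhere; all factors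
  except \<open>fst p\<close> and \<open>q p\<close> are nonzero, which contradicts
  \<open>pos\<close>.\<close>

lemma moment_tangent_strict:
  assumes q: "integrable \<mu> q" "AE p in \<mu>. 0 \<le> q p" and x: "0 < x" and y: "0 < y"
    and ne: "x \<noteq> y" and pos: "0 < (\<integral>p. fst p * q p \<partial>\<mu>)"
  shows "moment q 0 1 y < moment q 0 1 x + (x / y - 1) * x * moment q 1 2 x"
proof (rule ccontr)
  note gap = moment_tangent_gap[OF q x y]
  assume "\<not> ?thesis"
  then have "(\<integral>p. q p * (\<phi> * fst p * (x - y)\<^sup>2 /
    (y * (\<phi> + y * fst p) * (\<phi> + x * fst p)\<^sup>2)) \<partial>\<mu>) = 0"
    using gap(3) integral_nonneg_AE[OF gap(2)] by linarith
  then have "AE p in \<mu>. q p * (\<phi> * fst p * (x - y)\<^sup>2 /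
    (y * (\<phi> + y * fst p) * (\<phi> + x * fst p)\<^sup>2)) = 0"
    using integral_nonneg_eq_0_iff_AE[OF gap(1,2)] by simp
  then have "AE p in \<mu>. fst p * q p = 0"
    using nonneg
  proof eventually_elim
    case (elim p)
    then show ?case
      using denominator_pos[OF x, of "fst p"] denominator_pos[OF y, of "fst p"] y phi_pos ne
      by auto
  qed
  then have "(\<integral>p. fst p * q p \<partial>\<mu>) = 0" by (simp add: integral_eq_zero_AE)
  then show False using pos by simp
qed

section \<open>The effective resolvent variable\<close>

text \<open>Expresses \<open>g\<close> as an explicit function of \<open>x\<close>. Since
  \<open>1 / 0 = 0\<close>, the equation can be inverted without assuming a nonzero
  denominator.\<close>

lemma is_root_iff:
  "is_root \<phi> \<mu> g x \<longleftrightarrow> 0 < x \<and> g = 1 / x - \<phi> * moment fst 0 1 x"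
proof -
  have "x = 1 / (g + I) \<longleftrightarrow> g = 1 / x - I" if "0 < x" for I :: real
  proof
    assume "x = 1 / (g + I)"
    then have "1 / x = g + I" by simp
    then show "g = 1 / x - I" by simp
  next
    assume "g = 1 / x - I"
    then have "g + I = 1 / x" by simp
    then show "x = 1 / (g + I)" by simp
  qed
  then show ?thesis unfolding is_root_def One_nat_def Ifun_moment by (metis One_nat_def)
qed

text \<open>The equation multiplied by its denominator reads \<open>F x = 1\<close>, which also
  makes sense at \<open>x = 0\<close>; the intermediate value theorem on \<open>{0..1/g}\<close>
  applies.\<close>

lemma root_exists:
  assumes g: "0 < g"
  shows "\<exists>x. is_root \<phi> \<mu> g x"
proof -
  define f where "f x p = \<phi> * (x * fst p) / (\<phi> + x * fst p)" for x and p :: "real \<times> real"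
  define F where "F x = g * x + (\<integral>p. f x p \<partial>\<mu>)" for x
  have f_moment: "f x = (\<lambda>p. \<phi> * x * (fst p * fst p ^ 0 / (\<phi> + x * fst p) ^ 1))" for x
    by (simp add: f_def fun_eq_iff)
  have int: "integrable \<mu> (f x)" if "0 \<le> x" for x
    using integrable_mult_right[OF integrable_moment[OF integrable_fst, of x 0 1], of "\<phi> * x"] that
    by (cases "x = 0") (auto simp: f_moment)
  \<comment> \<open>The Lipschitz constant \<open>fst p\<close> is integrable, so continuity
    survives integration.\<close>
  have f_lip: "\<bar>f x p - f y p\<bar> \<le> fst p * \<bar>x - y\<bar>" if "0 \<le> x" "0 \<le> y" "0 \<le> fst p" for x y p
  proof -
    let ?a = "\<phi> + x * fst p" and ?b = "\<phi> + y * fst p"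
    have ab: "\<phi> \<le> ?a" "\<phi> \<le> ?b" using that by auto
    then have ab0: "0 < ?a" "0 < ?b" using phi_pos by linarith+
    have "f x p - f y p = (\<phi> * \<phi> * fst p * (x - y)) / (?a * ?b)"
      unfolding f_def using ab0 by (simp add: diff_frac_eq) (simp add: algebra_simps)
    moreover have "\<phi> * \<phi> \<le> ?a * ?b" using ab phi_pos by (intro mult_mono) auto
    ultimately have "\<bar>f x p - f y p\<bar> = (\<phi> * \<phi> / (?a * ?b)) * (fst p * \<bar>x - y\<bar>)"
      using ab0 that phi_pos by (simp add: abs_mult abs_div_pos)
    also have "\<dots> \<le> 1 * (fst p * \<bar>x - y\<bar>)"
      using \<open>\<phi> * \<phi> \<le> ?a * ?b\<close> ab0 that by (intro mult_right_mono) (auto simp: divide_le_eq)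
    finally show ?thesis by simp
  qed
  have lip: "\<bar>F x - F y\<bar> \<le> (g + train_scale \<mu>) * \<bar>x - y\<bar>" if xy: "0 \<le> x" "0 \<le> y" for x y
  proof -
    have "\<bar>(\<integral>p. f x p - f y p \<partial>\<mu>)\<bar> \<le> (\<integral>p. \<bar>f x p - f y p\<bar> \<partial>\<mu>)"
      by (rule integral_abs_bound)
    also have "\<dots> \<le> (\<integral>p. fst p * \<bar>x - y\<bar> \<partial>\<mu>)"
      using nonneg f_lip xy int integrable_fst by (intro integral_mono_AE) auto
    finally have "\<bar>(\<integral>p. f x p - f y p \<partial>\<mu>)\<bar> \<le> train_scale \<mu> * \<bar>x - y\<bar>"
      by (simp add: train_scale_def)
    moreover have "F x - F y = g * (x - y) + (\<integral>p. f x p - f y p \<partial>\<mu>)"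
      using int xy by (simp add: F_def algebra_simps)
    moreover have "\<bar>g * (x - y)\<bar> = g * \<bar>x - y\<bar>" using g by (simp add: abs_mult)
    ultimately show ?thesis by (simp add: algebra_simps)
  qed
  have "(g + train_scale \<mu>)-lipschitz_on {0..1/g} F"
    using g train_pos by (intro lipschitz_onI) (auto simp: dist_real_def intro: lip)
  then have cont: "continuous_on {0..1/g} F" by (rule lipschitz_on_continuous_on)
  have "F 0 \<le> 1" by (simp add: F_def f_def)
  moreover have "1 \<le> F (1/g)"
  proof -
    have "0 \<le> (\<integral>p. f (1/g) p \<partial>\<mu>)"
      using nonneg g phi_pos by (intro integral_nonneg_AE) (auto simp: f_def elim!: eventually_mono)
    then show ?thesis using g by (simp add: F_def)
  qed
  ultimately obtain x where x: "0 \<le> x" "F x = 1"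
    using IVT'[of F 0 1 "1/g"] cont g by auto
  have "x \<noteq> 0" using x by (auto simp: F_def f_def)
  then have x0: "0 < x" using x by simp
  have "(\<integral>p. f x p \<partial>\<mu>) = \<phi> * x * moment fst 0 1 x"
    unfolding f_moment moment_def by (rule integral_mult_right_zero)
  then have "is_root \<phi> \<mu> g x"
    using x x0 by (simp add: is_root_iff F_def field_simps)
  then show ?thesis ..
qed

text \<open>Convexity of \<open>g\<close> in \<open>t = 1 / x\<close>: the increment of
  \<open>g\<close> dominates that of the tangent at \<open>1 / x\<close>.\<close>

lemma root_gap:
  assumes x: "is_root \<phi> \<mu> g x" and y: "is_root \<phi> \<mu> g0 y"
  shows "(x / y - 1) * (g + \<phi> * Ifun \<phi> \<mu> 1 2 x) \<le> g0 - g"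
proof -
  have x0: "0 < x" and y0: "0 < y" and gx: "g = 1 / x - \<phi> * moment fst 0 1 x"
    and gy: "g0 = 1 / y - \<phi> * moment fst 0 1 y"
    using x y by (auto simp: is_root_iff)
  have I: "Ifun \<phi> \<mu> 1 2 x = \<phi> * moment fst 0 2 x" using Ifun_moment[of 0 2 x] by simp
  let ?c = "(x / y - 1) * (x * moment fst 1 2 x)"
  have "\<phi> * moment fst 0 1 y \<le> \<phi> * (moment fst 0 1 x + ?c)"
    using moment_tangent[OF integrable_fst _ x0 y0] nonneg phi_pos by (auto simp: mult.assoc)
  moreover have "(x / y - 1) * (1 / x) = 1 / y - 1 / x" using x0 y0 by (simp add: field_simps)
  \<comment> \<open>The denominator of the variance term is thus the derivative of \<open>g\<close>
    in \<open>t\<close>, divided by \<open>x\<close>.\<close>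
  moreover have "g + \<phi> * Ifun \<phi> \<mu> 1 2 x = 1 / x - \<phi> * (x * moment fst 1 2 x)"
    unfolding gx I moment_split[OF integrable_fst x0] by (simp add: algebra_simps)
  then have "(x / y - 1) * (g + \<phi> * Ifun \<phi> \<mu> 1 2 x) = (x / y - 1) * (1 / x) - \<phi> * ?c"
    by (simp only: right_diff_distrib) (simp only: mult_ac)
  ultimately show ?thesis
    unfolding gy by (simp add: gx distrib_left)
qed

text \<open>Hence \<open>g\<close> is strictly increasing in \<open>t\<close> wherever
  \<open>g\<close> is nonnegative, the ridgeless case included.\<close>

lemma derivative_denominator_pos:
  assumes "0 \<le> g" and "0 < x"
  shows "0 < g + \<phi> * Ifun \<phi> \<mu> 1 2 x"
  using moment_fst_pos[OF assms(2), of 2] Ifun_moment[of 0 2 x] phi_pos assms(1)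
  by (simp add: add_nonneg_pos)

text \<open>For two roots of the same \<open>g\<close> the right side of \<open>root_gap\<close> is
  \<open>0\<close>, so neither root exceeds the other.\<close>

lemma root_unique:
  assumes "0 \<le> g" and x: "is_root \<phi> \<mu> g x" and y: "is_root \<phi> \<mu> g y"
  shows "x = y"
proof -
  have le: "a \<le> b" if ab: "is_root \<phi> \<mu> g a" "is_root \<phi> \<mu> g b" for a b
  proof -
    have a0: "0 < a" "0 < b" using ab by (auto simp: is_root_def)
    then have "a / b - 1 \<le> 0"
      using root_gap[OF ab] derivative_denominator_pos[OF assms(1) a0(1)]
      by (simp add: mult_le_0_iff)
    then show ?thesis using a0 by (simp add: field_simps)
  qed
  show ?thesis using le[OF x y] le[OF y x] by simp
qed

lemma root_ex1:
  assumes "0 < g"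
  shows "\<exists>!x. is_root \<phi> \<mu> g x"
  using root_exists[OF assms] root_unique[of g] assms by (auto intro: less_imp_le)

section \<open>The test error as a tangent line\<close>

text \<open>\<open>slope g x\<close> is the derivative of \<open>g \<mapsto> Istar \<phi> \<mu> 1 1 (x g)\<close>.\<close>

definition slope :: "real \<Rightarrow> real \<Rightarrow> real" where
  "slope g x = x * Istar \<phi> \<mu> 2 2 x / (g + \<phi> * Ifun \<phi> \<mu> 1 2 x)"

lemma slope_nonneg:
  assumes "0 \<le> g" "0 < x"
  shows "0 \<le> slope g x"
  using moment_nonneg[of snd x 1 2] nonneg assms derivative_denominator_pos[OF assms]
    Istar_moment[of 1 2 x] phi_pos
  by (auto simp: slope_def numeral_2_eq_2)

text \<open>The noise quotient is \<open>1 + (v - g) / D\<close> with \<open>D\<close> its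
  denominator; the part without \<open>v - g\<close> collapses to
  \<open>Istar \<phi> \<mu> 1 1 x\<close> by \<open>moment_split\<close>.\<close>

lemma error_eq_tangent:
  assumes "0 \<le> g" "0 < x"
  shows "bias \<phi> \<mu> x + variance_term \<phi> v \<mu> g x = Istar \<phi> \<mu> 1 1 x + slope g x * (v - g)"
proof -
  let ?D = "g + \<phi> * Ifun \<phi> \<mu> 1 2 x"
  have D: "?D \<noteq> 0" using derivative_denominator_pos[OF assms] by simp
  have "v + \<phi> * Ifun \<phi> \<mu> 1 2 x = ?D + (v - g)" by simp
  then have "(v + \<phi> * Ifun \<phi> \<mu> 1 2 x) / ?D = 1 + (v - g) / ?D"
    using D by (simp only: add_divide_distrib[of ?D "v - g"]) simp
  then have "variance_term \<phi> v \<mu> g x = x * Istar \<phi> \<mu> 2 2 x + slope g x * (v - g)"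
    unfolding variance_term_def slope_def by (simp add: algebra_simps)
  moreover have "Istar \<phi> \<mu> 1 1 x = \<phi> * Istar \<phi> \<mu> 1 2 x + x * Istar \<phi> \<mu> 2 2 x"
    using Istar_moment[of 0 1 x] Istar_moment[of 0 2 x] Istar_moment[of 1 2 x]
      moment_split[OF integrable_snd assms(2)]
    by (simp add: numeral_2_eq_2 algebra_simps)
  ultimately show ?thesis by (simp add: bias_def)
qed

text \<open>Passes from increments in \<open>t\<close> to increments in \<open>g\<close>:
  \<open>root_gap\<close> is multiplied by the nonnegative
  \<open>x * Istar \<phi> \<mu> 2 2 x\<close>.\<close>

lemma Istar_le_tangent:
  assumes g: "0 \<le> g" and x: "is_root \<phi> \<mu> g x" and y: "is_root \<phi> \<mu> g0 y"
  shows "Istar \<phi> \<mu> 1 1 x + (x / y - 1) * x * Istar \<phi> \<mu> 2 2 x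
    \<le> Istar \<phi> \<mu> 1 1 x + slope g x * (g0 - g)"
proof -
  have x0: "0 < x" using x by (simp add: is_root_def)
  have D: "0 < g + \<phi> * Ifun \<phi> \<mu> 1 2 x" by (rule derivative_denominator_pos[OF g x0])
  then have "x / y - 1 \<le> (g0 - g) / (g + \<phi> * Ifun \<phi> \<mu> 1 2 x)"
    using root_gap[OF x y] by (simp add: le_divide_eq)
  moreover have "0 \<le> x * Istar \<phi> \<mu> 2 2 x"
    using moment_nonneg[of snd x 1 2] nonneg x0 phi_pos Istar_moment[of 1 2 x]
    by (auto simp: numeral_2_eq_2)
  ultimately have "(x / y - 1) * (x * Istar \<phi> \<mu> 2 2 x)
    \<le> (g0 - g) / (g + \<phi> * Ifun \<phi> \<mu> 1 2 x) * (x * Istar \<phi> \<mu> 2 2 x)"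
    by (rule mult_right_mono)
  then show ?thesis by (simp add: slope_def mult_ac)
qed

lemma Istar_tangent:
  assumes g: "0 \<le> g" and x: "is_root \<phi> \<mu> g x" and y: "is_root \<phi> \<mu> g0 y"
  shows "Istar \<phi> \<mu> 1 1 y \<le> Istar \<phi> \<mu> 1 1 x + slope g x * (g0 - g)"
proof -
  have "moment snd 0 1 y \<le> moment snd 0 1 x + (x / y - 1) * x * moment snd 1 2 x"
    using x y nonneg by (intro moment_tangent integrable_snd) (auto simp: is_root_def)
  then have "\<phi> * moment snd 0 1 y \<le> \<phi> * (moment snd 0 1 x + (x / y - 1) * x * moment snd 1 2 x)"
    using phi_pos by simp
  then show ?thesis
    using Istar_le_tangent[OF assms] Istar_moment[of 0 1 x] Istar_moment[of 0 1 y]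
      Istar_moment[of 1 2 x]
    by (simp add: numeral_2_eq_2 algebra_simps)
qed

text \<open>Distinct ridge constants have distinct roots, so strictness comes from the concavity in
  \<open>t\<close>.\<close>

lemma Istar_tangent_strict:
  assumes g: "0 \<le> g" and x: "is_root \<phi> \<mu> g x" and y: "is_root \<phi> \<mu> g0 y"
    and ne: "g \<noteq> g0" and pos: "0 < (\<integral>p. fst p * snd p \<partial>\<mu>)"
  shows "Istar \<phi> \<mu> 1 1 y < Istar \<phi> \<mu> 1 1 x + slope g x * (g0 - g)"
proof -
  have "x \<noteq> y" using x y ne by (auto simp: is_root_iff)
  then have "moment snd 0 1 y < moment snd 0 1 x + (x / y - 1) * x * moment snd 1 2 x"
    using x y nonneg pos by (intro moment_tangent_strict integrable_snd) (auto simp: is_root_def)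
  then have "\<phi> * moment snd 0 1 y < \<phi> * (moment snd 0 1 x + (x / y - 1) * x * moment snd 1 2 x)"
    using phi_pos by simp
  then show ?thesis
    using Istar_le_tangent[OF g x y] Istar_moment[of 0 1 x] Istar_moment[of 0 1 y]
      Istar_moment[of 1 2 x]
    by (simp add: numeral_2_eq_2 algebra_simps)
qed

section \<open>Optimality of the regularization\<close>

abbreviation error_at :: "real \<Rightarrow> real \<Rightarrow> ereal" where
  "error_at v \<equiv> at_root \<phi> \<mu> (\<lambda>g x. bias \<phi> \<mu> x + variance_term \<phi> v \<mu> g x)"

abbreviation has_root :: "real \<Rightarrow> bool" where
  "has_root g \<equiv> (\<exists>!x. is_root \<phi> \<mu> g x)"

definition h :: "real \<Rightarrow> real" where
  "h g = Istar \<phi> \<mu> 1 1 (root_x \<phi> \<mu> g)"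

definition dh :: "real \<Rightarrow> real" where
  "dh g = slope g (root_x \<phi> \<mu> g)"

lemma root_x_is_root:
  assumes "has_root g"
  shows "is_root \<phi> \<mu> g (root_x \<phi> \<mu> g)"
  unfolding root_x_def by (rule theI'[OF assms])

lemma error_at_root_x:
  assumes "0 \<le> g" "has_root g"
  shows "bias \<phi> \<mu> (root_x \<phi> \<mu> g) + variance_term \<phi> v \<mu> g (root_x \<phi> \<mu> g) = h g + dh g * (v - g)"
  using error_eq_tangent[of g] root_x_is_root[OF assms(2)] assms(1)
  by (simp add: is_root_def h_def dh_def)

lemma error_at_has_root:
  assumes "0 \<le> g" "has_root g"
  shows "error_at v g = ereal (h g + dh g * (v - g))"
  using error_at_root_x[OF assms] assms(2) by (simp add: at_root_def)

lemma h_tangent: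
  assumes "0 \<le> a" "has_root a" "has_root b"
  shows "h b \<le> h a + dh a * (b - a)"
  unfolding h_def dh_def using assms by (intro Istar_tangent root_x_is_root)

lemma h_tangent_strict:
  assumes "0 \<le> a" "has_root a" "has_root b" "a \<noteq> b" "0 < (\<integral>p. fst p * snd p \<partial>\<mu>)"
  shows "h b < h a + dh a * (b - a)"
  unfolding h_def dh_def using assms by (intro Istar_tangent_strict root_x_is_root)

lemma dh_nonneg:
  assumes "0 < g"
  shows "0 \<le> dh g"
  using slope_nonneg[of g] root_x_is_root[OF root_ex1[OF assms]] assms
  by (simp add: dh_def is_root_def)

lemma h_mono:
  assumes "0 < a" "a \<le> b"
  shows "h a \<le> h b"
proof -
  have "dh b * (a - b) \<le> 0" using dh_nonneg[of b] assms by (simp add: mult_le_0_iff)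
  then show ?thesis using h_tangent[of b a] root_ex1 assms by simp
qed

text \<open>Add the tangent inequality at \<open>a\<close>, read at \<open>b\<close>, to the one at
  \<open>b\<close>, read at \<open>a\<close>.\<close>

lemma dh_antimono:
  assumes "0 < a" "a \<le> b"
  shows "dh b \<le> dh a"
proof (cases "a = b")
  case False
  have "(dh b - dh a) * (b - a) \<le> 0"
    using h_tangent[of a b] h_tangent[of b a] root_ex1 assms by (simp add: algebra_simps)
  then show ?thesis using assms False by (simp add: mult_le_0_iff)
qed simp

text \<open>For a concave function, moving the point of contact away from \<open>v\<close> raises
  the tangent's value at \<open>v\<close>. So the error decreases in \<open>g\<close> up to the
  noise level.\<close>

lemma tangent_antimono:
  assumes "0 < a" "a \<le> b" "b \<le> v"
  shows "h b + dh b * (v - b) \<le> h a + dh a * (v - a)"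
proof -
  have "dh b * (v - b) \<le> dh a * (v - b)"
    using dh_antimono assms by (intro mult_right_mono) auto
  then show ?thesis using h_tangent[of a b] root_ex1 assms by (simp add: algebra_simps)
qed

section \<open>The ridgeless end point\<close>

lemma h_tendsto:
  "((\<lambda>g. ereal (h g)) \<longlongrightarrow> Lim (at_right 0) (\<lambda>g. ereal (h g))) (at_right 0)"
  by (rule mono_tendsto_at_right) (simp add: h_mono)

text \<open>Let \<open>b\<close> decrease to \<open>0\<close> in the tangent inequality with
  \<open>a\<close> fixed.\<close>

lemma h_limit_le:
  assumes a: "0 < a"
  shows "Lim (at_right 0) (\<lambda>g. ereal (h g)) \<le> ereal (h a + dh a * (0 - a))"
proof (rule tendsto_le)
  show "((\<lambda>b. ereal (h a + dh a * (b - a))) \<longlongrightarrow> ereal (h a + dh a * (0 - a))) (at_right 0)"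
    by (intro tendsto_intros)
  show "\<forall>\<^sub>F b in at_right 0. ereal (h b) \<le> ereal (h a + dh a * (b - a))"
    using eventually_at_right_less[of 0]
    by eventually_elim (use h_tangent[of a] root_ex1 a in simp)
qed (simp_all add: h_tendsto)

text \<open>The tangent form of the error is available at every \<open>g > 0\<close>, which is all
  that a right limit sees.\<close>

lemma error_at_zero_limit:
  assumes "\<not> has_root 0" and l: "((\<lambda>g. ereal (h g + dh g * (v - g))) \<longlongrightarrow> l) (at_right 0)"
  shows "error_at v 0 = l"
proof -
  have "((\<lambda>g. ereal (bias \<phi> \<mu> (root_x \<phi> \<mu> g) + variance_term \<phi> v \<mu> g (root_x \<phi> \<mu> g)))
    \<longlongrightarrow> l) (at_right 0)"
  proof (rule Lim_transform_eventually[OF l])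
    show "\<forall>\<^sub>F g in at_right 0. ereal (h g + dh g * (v - g)) =
      ereal (bias \<phi> \<mu> (root_x \<phi> \<mu> g) + variance_term \<phi> v \<mu> g (root_x \<phi> \<mu> g))"
      using eventually_at_right_less[of 0]
      by eventually_elim (simp add: error_at_root_x root_ex1)
  qed
  then show ?thesis
    using assms(1) tendsto_Lim[of "at_right (0::real)"] by (simp add: at_root_def)
qed

lemma Istar_at_zero_limit:
  assumes "\<not> has_root 0"
  shows "at_root \<phi> \<mu> (\<lambda>g. Istar \<phi> \<mu> 1 1) 0 = Lim (at_right 0) (\<lambda>g. ereal (h g))"
  using assms by (simp add: at_root_def h_def)

text \<open>The error lies between the limit of \<open>h\<close> and \<open>h g\<close>, so
  \<open>g * dh g\<close> needs no separate estimate, although \<open>dh\<close> may be unbounded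
  near \<open>0\<close>.\<close>

lemma error_at_zero_noiseless:
  assumes "\<not> has_root 0"
  shows "error_at 0 0 = Lim (at_right 0) (\<lambda>g. ereal (h g))"
proof (rule error_at_zero_limit[OF assms])
  show "((\<lambda>g. ereal (h g + dh g * (0 - g))) \<longlongrightarrow> Lim (at_right 0) (\<lambda>g. ereal (h g))) (at_right 0)"
  proof (rule tendsto_sandwich[OF _ _ tendsto_const h_tendsto])
    show "\<forall>\<^sub>F g in at_right 0. Lim (at_right 0) (\<lambda>g. ereal (h g)) \<le> ereal (h g + dh g * (0 - g))"
      using eventually_at_right_less[of 0] by eventually_elim (rule h_limit_le)
    show "\<forall>\<^sub>F g in at_right 0. ereal (h g + dh g * (0 - g)) \<le> ereal (h g)"
      using eventually_at_right_less[of 0] by eventually_elim (simp add: dh_nonneg)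
  qed
qed

lemma error_at_opt:
  assumes v: "0 \<le> v"
  shows "error_at v v = at_root \<phi> \<mu> (\<lambda>g. Istar \<phi> \<mu> 1 1) v"
proof (cases "has_root v")
  case True
  then show ?thesis
    using error_at_has_root[OF v, of v] by (simp add: at_root_def h_def)
next
  case False
  then have "v = 0" using v root_ex1[of v] by (cases "v = 0") auto
  then show ?thesis
    using False error_at_zero_noiseless Istar_at_zero_limit by simp
qed

lemma error_at_min:
  assumes v: "0 \<le> v" and g: "0 \<le> g" and ne: "g \<noteq> v"
  shows "error_at v v \<le> error_at v g"
    and "0 < (\<integral>p. fst p * snd p \<partial>\<mu>) \<Longrightarrow> error_at v v < error_at v g"
proof -
  \<comment> \<open>A root can be missing only at \<open>0\<close>, and \<open>g \<noteq> v\<close>,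
    so at most one of the two errors is a limit.\<close>
  consider "has_root v" "has_root g" | "\<not> has_root g" "g = 0" "0 < v"
    | "\<not> has_root v" "v = 0" "0 < g"
    using v g ne root_ex1[of v] root_ex1[of g] by (cases "v = 0"; cases "g = 0") auto
  then have "error_at v v \<le> error_at v g \<and>
    (0 < (\<integral>p. fst p * snd p \<partial>\<mu>) \<longrightarrow> error_at v v < error_at v g)"
  proof cases
    case 1
    then show ?thesis
      using error_at_has_root[OF v] error_at_has_root[OF g] h_tangent[OF g]
        h_tangent_strict[OF g] ne by simp
  next
    case 2
    let ?T = "\<lambda>a. h a + dh a * (v - a)"
    have "((\<lambda>a. ereal (?T a)) \<longlongrightarrow> (SUP a\<in>{0<..<v}. ereal (?T a))) (at_right 0)"
      by (rule antimono_tendsto_at_right) (use 2 tangent_antimono in auto)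
    then have "error_at v g = (SUP a\<in>{0<..<v}. ereal (?T a))"
      using error_at_zero_limit[of v] 2 by simp
    \<comment> \<open>Any point strictly between \<open>0\<close> and \<open>v\<close> would do: its
      tangent value at \<open>v\<close> already separates the supremum from
      \<open>h v\<close>.\<close>
    also have "\<dots> \<ge> ereal (?T (v / 2))"
      using 2 by (intro SUP_upper) auto
    finally have "ereal (?T (v / 2)) \<le> error_at v g" .
    moreover have "error_at v v = ereal (h v)"
      using error_at_has_root[OF v root_ex1] 2 by simp
    moreover have "h v \<le> ?T (v / 2)"
      using h_tangent[of "v / 2" v] root_ex1 2 by simp
    moreover have "h v < ?T (v / 2)" if "0 < (\<integral>p. fst p * snd p \<partial>\<mu>)"
      using h_tangent_strict[of "v / 2" v] root_ex1 2 that by simp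
    ultimately show ?thesis
      using order_trans[of "ereal (h v)" "ereal (?T (v / 2))" "error_at v g"]
        less_le_trans[of "ereal (h v)" "ereal (?T (v / 2))" "error_at v g"] by simp
  next
    case 3
    let ?T = "\<lambda>a. h a + dh a * (0 - a)"
    have err: "error_at v g = ereal (?T g)"
      using error_at_has_root[OF g root_ex1] 3 by simp
    have opt: "error_at v v = Lim (at_right 0) (\<lambda>g. ereal (h g))"
      using error_at_zero_noiseless 3 by simp
    \<comment> \<open>Passing to the limit loses strictness, so the strict inequality is taken
      between the tangents at \<open>g / 2\<close> and \<open>g\<close>, both read at
      \<open>0\<close>.\<close>
    have "error_at v v < error_at v g" if "0 < (\<integral>p. fst p * snd p \<partial>\<mu>)"
    proof -
      have "dh g * (g / 2) \<le> dh (g / 2) * (g / 2)"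
        using dh_antimono[of "g / 2" g] 3 by (intro mult_right_mono) auto
      moreover have "h (g / 2) < h g + dh g * (g / 2 - g)"
        using h_tangent_strict[of g "g / 2"] root_ex1 3 that by simp
      ultimately have "?T (g / 2) < ?T g" by (simp add: algebra_simps)
      then show ?thesis
        using h_limit_le[of "g / 2"] 3 unfolding err opt
        by (simp add: le_less_trans)
    qed
    then show ?thesis using h_limit_le[of g] 3 unfolding err opt by simp
  qed
  then show "error_at v v \<le> error_at v g"
    and "0 < (\<integral>p. fst p * snd p \<partial>\<mu>) \<Longrightarrow> error_at v v < error_at v g" by auto
qed

end

section \<open>Monotonicity in the shift strength\<close>

text \<open>The complement of the support is covered by null balls, of which countably many suffice
  by Lindelof.\<close>

lemma AE_msupport:
  fixes M :: "real measure"
  assumes M: "sets M = sets borel"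
  shows "AE x in M. x \<in> msupport M"
proof -
  let ?B = "{B. (\<exists>x e. 0 < e \<and> B = ball x e) \<and> emeasure M B = 0}"
  obtain B where B: "B \<subseteq> ?B" "countable B" "\<Union>B = \<Union>?B"
    using Lindelof[of ?B] by auto
  have "(\<Union>b\<in>B. b) \<in> null_sets M"
    using B by (intro null_sets_UN') (auto simp: null_sets_def M)
  moreover have "{x \<in> space M. x \<notin> msupport M} \<subseteq> (\<Union>b\<in>B. b)"
  proof
    fix x assume "x \<in> {x \<in> space M. x \<notin> msupport M}"
    then obtain e where "0 < e" "emeasure M (ball x e) = 0"
      by (auto simp: msupport_def zero_less_iff_neq_zero)
    then have "x \<in> \<Union>?B" by (intro UnionI[of "ball x e"]) auto
    then show "x \<in> (\<Union>b\<in>B. b)" using B(3) by simp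
  qed
  ultimately show ?thesis by (rule AE_I')
qed

text \<open>For \<open>b = 0 < a\<close> the quotient is infinite, so comparing the ratio with
  \<open>1\<close> stays correct there.\<close>

lemma one_le_ennreal_divide_iff:
  assumes "0 \<le> a" "0 \<le> b" "\<not> (a = 0 \<and> b = 0)"
  shows "1 \<le> ennreal a / ennreal b \<longleftrightarrow> b \<le> a"
proof (cases "b = 0")
  case True
  then show ?thesis using assms by (auto simp: ennreal_eq_0_iff)
next
  case False
  then show ?thesis using assms by (simp add: divide_ennreal le_divide_eq flip: ennreal_1)
qed

text \<open>A nondecreasing ratio makes \<open>f - g\<close> change sign at most once, from nonpositive to
  nonnegative, at some \<open>c\<close>; then \<open>(f - g) * (k - k c)\<close> is nonpositive.\<close>

lemma integral_le_of_monotone_ratio: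
  fixes f g k :: "real \<Rightarrow> real"
  assumes M: "sets M = sets borel" and M0: "AE l in M. 0 \<le> l"
    and f0: "\<And>l. 0 \<le> f l" and g0: "\<And>l. 0 \<le> g l" and k0: "\<And>l. 0 \<le> l \<Longrightarrow> 0 \<le> k l"
    and ratio: "mono_on {l \<in> msupport M. \<not> (f l = 0 \<and> g l = 0)} (\<lambda>l. ennreal (f l) / ennreal (g l))"
    and k: "\<And>l m. 0 \<le> l \<Longrightarrow> l \<le> m \<Longrightarrow> k m \<le> k l"
    and int: "integrable M f" "integrable M g"
      "integrable M (\<lambda>l. k l * f l)" "integrable M (\<lambda>l. k l * g l)"
    and le: "(\<integral>l. f l \<partial>M) \<le> (\<integral>l. g l \<partial>M)"
  shows "(\<integral>l. k l * f l \<partial>M) \<le> (\<integral>l. k l * g l \<partial>M)"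
proof -
  \<comment> \<open>The crossing point is \<open>Inf P\<close>, and \<open>d\<close> below is the
    value of \<open>k\<close> there.\<close>
  define P where "P = {l \<in> msupport M. 0 \<le> l \<and> g l < f l}"
  have "\<exists>d\<ge>0. \<forall>l\<in>msupport M. 0 \<le> l \<longrightarrow> k l * f l - k l * g l \<le> d * (f l - g l)"
    if ne: "P \<noteq> {}"
  proof (intro exI[of _ "k (Inf P)"] conjI ballI impI)
    have c0: "0 \<le> Inf P" using ne by (intro cInf_greatest) (auto simp: P_def)
    then show "0 \<le> k (Inf P)" by (rule k0)
    have bdd: "bdd_below P" by (auto simp: P_def intro: bdd_belowI)
    fix l assume l: "l \<in> msupport M" "0 \<le> l"
    have "(f l - g l) * (k l - k (Inf P)) \<le> 0"
    proof (cases l "Inf P" rule: linorder_cases)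
      case less
      then have "l \<notin> P" using cInf_lower[OF _ bdd, of l] by auto
      then have "f l \<le> g l" using l by (auto simp: P_def)
      moreover have "k (Inf P) \<le> k l" using k[of l "Inf P"] less l by simp
      ultimately show ?thesis by (simp add: mult_le_0_iff)
    next
      case greater
      then obtain p where p: "p \<in> P" "p < l" using cInf_lessD[OF ne] by auto
      have "g l \<le> f l"
      \<comment> \<open>Points with ratio \<open>0 / 0\<close> lie outside the monotonicity set, but
        there \<open>g l \<le> f l\<close> is trivial.\<close>
      proof (cases "f l = 0 \<and> g l = 0")
        case False
        have p0: "\<not> (f p = 0 \<and> g p = 0)" using p by (auto simp: P_def)
        have "1 \<le> ennreal (f p) / ennreal (g p)"
          using p p0 f0 g0 by (simp add: one_le_ennreal_divide_iff P_def)
        also have "\<dots> \<le> ennreal (f l) / ennreal (g l)"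
          using p p0 l False by (intro mono_onD[OF ratio]) (auto simp: P_def)
        finally show ?thesis using False f0 g0 by (simp add: one_le_ennreal_divide_iff)
      qed simp
      moreover have "k l \<le> k (Inf P)" using k[OF c0, of l] greater by simp
      ultimately show ?thesis by (simp add: mult_le_0_iff)
    qed simp
    then show "k l * f l - k l * g l \<le> k (Inf P) * (f l - g l)" by (simp add: algebra_simps)
  qed
  moreover have "\<exists>d\<ge>0. \<forall>l\<in>msupport M. 0 \<le> l \<longrightarrow> k l * f l - k l * g l \<le> d * (f l - g l)"
    if "P = {}"
  proof (intro exI[of _ 0] conjI ballI impI)
    fix l assume l: "l \<in> msupport M" "0 \<le> l"
    then have "f l \<le> g l" using that by (auto simp: P_def not_less)
    then have "k l * f l \<le> k l * g l" using k0 l by (intro mult_left_mono) auto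
    then show "k l * f l - k l * g l \<le> 0 * (f l - g l)" by simp
  qed simp
  ultimately have "\<exists>d\<ge>0. \<forall>l\<in>msupport M. 0 \<le> l \<longrightarrow> k l * f l - k l * g l \<le> d * (f l - g l)"
    by (cases "P = {}") simp_all
  then obtain d where d: "0 \<le> d"
    "\<And>l. l \<in> msupport M \<Longrightarrow> 0 \<le> l \<Longrightarrow> k l * f l - k l * g l \<le> d * (f l - g l)"
    by blast
  have "(\<integral>l. k l * f l - k l * g l \<partial>M) \<le> (\<integral>l. d * (f l - g l) \<partial>M)"
    using int M0 AE_msupport[OF M] d(2) by (intro integral_mono_AE) auto
  also have "\<dots> = d * ((\<integral>l. f l \<partial>M) - (\<integral>l. g l \<partial>M))" using int by simp
  \<comment> \<open>Here the sign of \<open>d\<close> meets the ordering of the total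
    masses.\<close>
  also have "\<dots> \<le> 0" using d(1) le by (simp add: mult_le_0_iff)
  finally show ?thesis using int by simp
qed

context joint_spectrum
begin

text \<open>The pull-out property of conditional expectation, moved to the marginal. It is applied
  with \<open>k = 1\<close> for the test scale and with \<open>1 / (\<phi> + x * l)\<close> for
  \<open>Istar\<close>.\<close>

lemma cond_mean_integral:
  assumes f: "cond_mean_version \<mu> f" and k: "k \<in> borel_measurable borel"
    and int: "integrable \<mu> (\<lambda>p. k (fst p) * snd p)"
  shows "integrable (mu_train \<mu>) (\<lambda>l. k l * f l)"
    and "(\<integral>l. k l * f l \<partial>mu_train \<mu>) = (\<integral>p. k (fst p) * snd p \<partial>\<mu>)"
proof -
  define F where "F = vimage_algebra (space \<mu>) fst (borel :: real measure)"
  have "subalgebra \<mu> F"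
    using measurable_fst_mu unfolding subalgebra_def F_def measurable_iff_sets by simp
  then interpret F: finite_measure_subalgebra \<mu> F by unfold_locales
  have fm [measurable]: "f \<in> borel_measurable borel" using f by (simp add: cond_mean_version_def)
  note k [measurable]
  have "fst \<in> borel_measurable F" unfolding F_def by (rule measurable_vimage_algebra1) simp
  then have kF: "(\<lambda>p. k (fst p)) \<in> borel_measurable F" by measurable
  note ce = F.real_cond_exp_intg[OF int kF measurable_snd_mu]
  have eq: "AE p in \<mu>. k (fst p) * real_cond_exp \<mu> F snd p = k (fst p) * f (fst p)"
    using f unfolding cond_mean_version_def F_def by auto
  have i: "integrable \<mu> (\<lambda>p. k (fst p) * f (fst p))"
    by (rule integrable_cong_AE_imp[OF ce(1)]) (use eq in auto)
  then show "integrable (mu_train \<mu>) (\<lambda>l. k l * f l)"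
    unfolding mu_train_def by (subst integrable_distr_eq) auto
  have "(\<integral>l. k l * f l \<partial>mu_train \<mu>) = (\<integral>p. k (fst p) * f (fst p) \<partial>\<mu>)"
    unfolding mu_train_def by (subst integral_distr) auto
  also have "\<dots> = (\<integral>p. k (fst p) * real_cond_exp \<mu> F snd p \<partial>\<mu>)"
    using eq i ce(1) by (intro integral_cong_AE) auto
  finally show "(\<integral>l. k l * f l \<partial>mu_train \<mu>) = (\<integral>p. k (fst p) * snd p \<partial>\<mu>)"
    using ce(2) by simp
qed

text \<open>The equation sees \<open>\<mu>\<close> only through its marginal, so comparable measures
  share their roots.\<close>

lemma is_root_mu_train:
  "is_root \<phi> \<mu> g x \<longleftrightarrow> 0 < x \<and> x = 1 / (g + \<phi> * (\<integral>l. l / (\<phi> + x * l) \<partial>mu_train \<mu>))"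
  unfolding is_root_def Ifun_def mu_train_def by (subst integral_distr) auto

end

lemma Istar_mono_shift:
  assumes 1: "joint_spectrum \<mu>1 \<phi>" and 2: "joint_spectrum \<mu>2 \<phi>"
    and le: "shift_le \<mu>1 \<mu>2" and x: "0 < x"
  shows "Istar \<phi> \<mu>1 1 1 x \<le> Istar \<phi> \<mu>2 1 1 x"
proof -
  interpret A: joint_spectrum \<mu>1 \<phi> by fact
  interpret B: joint_spectrum \<mu>2 \<phi> by fact
  obtain f g where fg: "cond_mean_version \<mu>1 f" "cond_mean_version \<mu>2 g"
    and ratio: "mono_on {l \<in> msupport (mu_train \<mu>1). \<not> (f l = 0 \<and> g l = 0)}
      (\<lambda>l. ennreal (f l) / ennreal (g l))"
    and tr: "mu_train \<mu>1 = mu_train \<mu>2" and te: "test_scale \<mu>1 \<le> test_scale \<mu>2"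
    using le unfolding shift_le_def by blast
  let ?k = "\<lambda>l. 1 / (\<phi> + x * l)"
  have k: "?k \<in> borel_measurable borel" by measurable
  have i1: "integrable \<mu>1 (\<lambda>p. ?k (fst p) * snd p)"
    using A.integrable_moment[OF A.integrable_snd x, of 0 1] by simp
  have i2: "integrable \<mu>2 (\<lambda>p. ?k (fst p) * snd p)"
    using B.integrable_moment[OF B.integrable_snd x, of 0 1] by simp
  note a = A.cond_mean_integral[OF fg(1)] and b = B.cond_mean_integral[OF fg(2)]
  have "(\<integral>l. ?k l * f l \<partial>mu_train \<mu>1) \<le> (\<integral>l. ?k l * g l \<partial>mu_train \<mu>1)"
  proof (rule integral_le_of_monotone_ratio[OF _ _ _ _ _ ratio])
    show "sets (mu_train \<mu>1) = sets borel" by (simp add: mu_train_def)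
    show "AE l in mu_train \<mu>1. 0 \<le> l"
      using A.nonneg unfolding mu_train_def by (subst AE_distr_iff) auto
    show "0 \<le> f l" "0 \<le> g l" for l using fg by (auto simp: cond_mean_version_def)
    show "0 \<le> ?k l" if "0 \<le> l" for l using A.denominator_pos[OF x that] by simp
    show "?k m \<le> ?k l" if "0 \<le> l" "l \<le> m" for l m
      using A.denominator_pos[OF x that(1)] A.denominator_pos[OF x, of m] that x
      by (intro divide_left_mono mult_pos_pos) auto
    show "integrable (mu_train \<mu>1) f" "integrable (mu_train \<mu>1) g"
      using a(1)[of "\<lambda>_. 1"] b(1)[of "\<lambda>_. 1"] A.integrable_snd B.integrable_snd tr by simp_all
    show "integrable (mu_train \<mu>1) (\<lambda>l. ?k l * f l)" by (rule a(1)[OF k i1])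
    show "integrable (mu_train \<mu>1) (\<lambda>l. ?k l * g l)" unfolding tr by (rule b(1)[OF k i2])
    show "(\<integral>l. f l \<partial>mu_train \<mu>1) \<le> (\<integral>l. g l \<partial>mu_train \<mu>1)"
      using a(2)[of "\<lambda>_. 1"] b(2)[of "\<lambda>_. 1"] A.integrable_snd B.integrable_snd tr te
      by (simp add: test_scale_def)
  qed
  then have "(\<integral>p. ?k (fst p) * snd p \<partial>\<mu>1) \<le> (\<integral>p. ?k (fst p) * snd p \<partial>\<mu>2)"
    using a(2)[OF k i1] b(2)[OF k i2] tr by simp
  then show ?thesis using A.phi_pos by (simp add: Istar_def)
qed

lemma error_at_opt_mono_shift:
  assumes 1: "joint_spectrum \<mu>1 \<phi>" and 2: "joint_spectrum \<mu>2 \<phi>"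
    and le: "shift_le \<mu>1 \<mu>2" and v: "0 \<le> v"
  shows "at_root \<phi> \<mu>1 (\<lambda>g. Istar \<phi> \<mu>1 1 1) v \<le> at_root \<phi> \<mu>2 (\<lambda>g. Istar \<phi> \<mu>2 1 1) v"
proof -
  interpret A: joint_spectrum \<mu>1 \<phi> by fact
  interpret B: joint_spectrum \<mu>2 \<phi> by fact
  have root: "is_root \<phi> \<mu>1 = is_root \<phi> \<mu>2"
    using le by (simp add: fun_eq_iff A.is_root_mu_train B.is_root_mu_train shift_le_def)
  have "A.h g \<le> B.h g" if "A.has_root g" for g
    using Istar_mono_shift[OF 1 2 le] A.root_x_is_root[OF that]
    unfolding A.h_def B.h_def root_x_def root is_root_def by blast
  note h = this
  show ?thesis
  proof (cases "A.has_root v")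
    case True
    then show ?thesis using h[OF True] root by (simp add: at_root_def A.h_def B.h_def)
  next
    case False
    then have v0: "v = 0" using v A.root_ex1[of v] by (cases "v = 0") auto
    \<comment> \<open>Without a root at \<open>0\<close> both optimal errors are limits of
      \<open>h\<close>, and the comparison at each \<open>g > 0\<close> passes to them.\<close>
    have "Lim (at_right 0) (\<lambda>g. ereal (A.h g)) \<le> Lim (at_right 0) (\<lambda>g. ereal (B.h g))"
    proof (rule tendsto_le[OF _ B.h_tendsto A.h_tendsto])
      show "\<forall>\<^sub>F g in at_right 0. ereal (A.h g) \<le> ereal (B.h g)"
        using eventually_at_right_less[of 0] by eventually_elim (simp add: h A.root_ex1)
    qed simp
    then show ?thesis
      using False root A.Istar_at_zero_limit B.Istar_at_zero_limit by (simp add: v0)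
  qed
qed

section \<open>Translation to the original ridge constant\<close>

lemma LJSD_joint_spectrum:
  assumes "LJSD \<mu>" and "0 < \<phi>"
  shows "joint_spectrum \<mu> \<phi>"
proof -
  obtain C where "AE p in \<mu>. p \<in> {0..C} \<times> {0..C}" using assms(1) by (auto simp only: LJSD_def)
  then have "AE p in \<mu>. 0 \<le> fst p \<and> 0 \<le> snd p"
    by (rule eventually_mono) (auto simp: mem_Times_iff)
  then show ?thesis
    using assms by (simp add: LJSD_def joint_spectrum_def joint_spectrum_axioms_def)
qed

theorem proposition6p1:
  fixes \<phi> v s :: real and \<sigma> :: "real \<Rightarrow> real"
  defines "\<rho> \<equiv> act_rho \<sigma> s" and "\<omega> \<equiv> act_omega \<sigma> s"
  defines "\<gamma>opt \<equiv> \<rho> * (v - \<omega>)"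
  assumes "\<phi> > 0" and "v \<ge> 0" and "s > 0"
    and "activation \<sigma>" and "act_zeta \<sigma> s \<noteq> 0"
  shows "(\<forall>\<mu>. LJSD \<mu> \<and> train_scale \<mu> = s \<and> test_scale \<mu> = s \<longrightarrow>
            is_arg_min (test_error \<phi> v \<sigma> \<mu>) (\<lambda>\<gamma>. \<gamma> \<ge> - \<rho> * \<omega>) \<gamma>opt \<and>
            ((\<integral>p. fst p * snd p \<partial>\<mu>) > 0 \<longrightarrow>
               {\<gamma>. is_arg_min (test_error \<phi> v \<sigma> \<mu>) (\<lambda>\<gamma>. \<gamma> \<ge> - \<rho> * \<omega>) \<gamma>} = {\<gamma>opt}) \<and>
            test_error \<phi> v \<sigma> \<mu> \<gamma>opt =
              at_root \<phi> \<mu> (\<lambda>g x. Istar \<phi> \<mu> 1 1 x) (gamma_eff \<sigma> s \<gamma>opt)) \<and>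
         (\<forall>\<mu>1 \<mu>2.
            LJSD \<mu>1 \<and> train_scale \<mu>1 = s \<and> test_scale \<mu>1 = s \<and>
            LJSD \<mu>2 \<and> train_scale \<mu>2 = s \<and> test_scale \<mu>2 = s \<and>
            shift_le \<mu>1 \<mu>2 \<longrightarrow>
            test_error \<phi> v \<sigma> \<mu>1 \<gamma>opt \<le> test_error \<phi> v \<sigma> \<mu>2 \<gamma>opt)"
proof -
  have "\<rho> \<noteq> 0" using \<open>act_zeta \<sigma> s \<noteq> 0\<close> by (auto simp: act_zeta_def \<rho>_def)
  then have \<rho>: "0 < \<rho>" by (simp add: \<rho>_def act_rho_def)
  have eff: "gamma_eff \<sigma> s \<gamma> = \<gamma> / \<rho> + \<omega>" for \<gamma>
    by (simp add: gamma_eff_def \<rho>_def \<omega>_def)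
  have eff_opt: "gamma_eff \<sigma> s \<gamma>opt = v" using \<rho> by (simp add: eff \<gamma>opt_def)
  \<comment> \<open>As \<open>\<rho> > 0\<close>, \<open>gamma_eff\<close> is an increasing affine
    bijection from the admissible ridge constants onto \<open>g \<ge> 0\<close>.\<close>
  have eff_nonneg: "0 \<le> gamma_eff \<sigma> s \<gamma> \<longleftrightarrow> - \<rho> * \<omega> \<le> \<gamma>" for \<gamma>
    using \<rho> by (auto simp: eff field_simps)
  have eff_eq: "gamma_eff \<sigma> s \<gamma> = v \<longleftrightarrow> \<gamma> = \<gamma>opt" for \<gamma>
    using \<rho> by (auto simp: eff \<gamma>opt_def field_simps)
  have opt_ge: "- \<rho> * \<omega> \<le> \<gamma>opt" using eff_nonneg[of \<gamma>opt] eff_opt \<open>v \<ge> 0\<close> by simp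
  have err: "test_error \<phi> v \<sigma> \<mu> \<gamma> =
      at_root \<phi> \<mu> (\<lambda>g x. bias \<phi> \<mu> x + variance_term \<phi> v \<mu> g x) (gamma_eff \<sigma> s \<gamma>)"
    if "train_scale \<mu> = s" for \<mu> \<gamma>
    using that by (simp add: test_error_def)
  have opt: "test_error \<phi> v \<sigma> \<mu> \<gamma>opt = at_root \<phi> \<mu> (\<lambda>g x. Istar \<phi> \<mu> 1 1 x) v"
    if "LJSD \<mu>" "train_scale \<mu> = s" for \<mu>
    using joint_spectrum.error_at_opt[OF LJSD_joint_spectrum] that \<open>\<phi> > 0\<close> \<open>v \<ge> 0\<close>
    by (simp add: err eff_opt)
  have min: "test_error \<phi> v \<sigma> \<mu> \<gamma>opt \<le> test_error \<phi> v \<sigma> \<mu> \<gamma>"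
    "0 < (\<integral>p. fst p * snd p \<partial>\<mu>) \<Longrightarrow> test_error \<phi> v \<sigma> \<mu> \<gamma>opt < test_error \<phi> v \<sigma> \<mu> \<gamma>"
    if "LJSD \<mu>" "train_scale \<mu> = s" "- \<rho> * \<omega> \<le> \<gamma>" "\<gamma> \<noteq> \<gamma>opt" for \<mu> \<gamma>
    using joint_spectrum.error_at_min[OF LJSD_joint_spectrum[OF that(1) \<open>\<phi> > 0\<close>] \<open>v \<ge> 0\<close>,
        of "gamma_eff \<sigma> s \<gamma>"] that eff_nonneg[of \<gamma>] eff_eq[of \<gamma>]
    by (simp_all add: err eff_opt)
  show ?thesis
  proof (intro conjI allI impI)
    fix \<mu> assume \<mu>: "LJSD \<mu> \<and> train_scale \<mu> = s \<and> test_scale \<mu> = s"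
    show arg: "is_arg_min (test_error \<phi> v \<sigma> \<mu>) (\<lambda>\<gamma>. \<gamma> \<ge> - \<rho> * \<omega>) \<gamma>opt"
      unfolding is_arg_min_def using \<mu> min(1) opt_ge by (metis leD less_irrefl)
    show "{\<gamma>. is_arg_min (test_error \<phi> v \<sigma> \<mu>) (\<lambda>\<gamma>. \<gamma> \<ge> - \<rho> * \<omega>) \<gamma>} = {\<gamma>opt}"
      if "0 < (\<integral>p. fst p * snd p \<partial>\<mu>)"
      using arg min(2)[of \<mu>] \<mu> that unfolding is_arg_min_def by blast
    show "test_error \<phi> v \<sigma> \<mu> \<gamma>opt =
        at_root \<phi> \<mu> (\<lambda>g x. Istar \<phi> \<mu> 1 1 x) (gamma_eff \<sigma> s \<gamma>opt)"
      using opt \<mu> eff_opt by simp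
  next
    fix \<mu>1 \<mu>2
    assume \<mu>: "LJSD \<mu>1 \<and> train_scale \<mu>1 = s \<and> test_scale \<mu>1 = s \<and>
      LJSD \<mu>2 \<and> train_scale \<mu>2 = s \<and> test_scale \<mu>2 = s \<and> shift_le \<mu>1 \<mu>2"
    then show "test_error \<phi> v \<sigma> \<mu>1 \<gamma>opt \<le> test_error \<phi> v \<sigma> \<mu>2 \<gamma>opt"
      using error_at_opt_mono_shift[of \<mu>1 \<phi> \<mu>2 v] LJSD_joint_spectrum[OF _ \<open>\<phi> > 0\<close>]
        \<open>v \<ge> 0\<close> opt by simp
  qed
qed

end
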